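(* Let $d\geq 2$ be even, and let $Q_{\partial(\sigma_{d+1})}$ be the interior polytope of $\widetilde{P}_{\partial(\sigma_{d+1})}\subseteq\mathbb{R}^d$. Let $\mathds{1}\in\mathbb{R}^d$ be the all-ones vector. Then: (a) The complete and irredundant facet description of $Q_{\partial(\sigma_{d+1})}$ is given by the inequalities (for $x\in\mathbb{R}^d$): (i) $\sum_{k=1}^d x_k\le d+1$; (ii) $\sum_{k\in[d],\,k\text{ odd}}x_k-x_i\le\frac d2$ for even $i\in[d]$; (iii) $\sum_{k\in[d],\,k\text{ even}}x_k-x_j\le\frac d2$ for odd $j\in[d]$; (iv) $x_i+x_j\ge1$ for $1\le i<j\le d$ such that $i+j$ is odd. (b) $Q_{\partial(\sigma_{d+1})}-\mathds{1}$ is reflexive. In particular, $\mathds{1}$ is the unique interior lattice point of $Q_{\partial(\sigma_{d+1})}$. (c) $2\cdot\left(Q_{\partial(\sigma_{d+1})}-\mathds{1}\right)=\widetilde{P}_{\partial(\sigma_{d+1})}-\mathds{1}$.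
   Context: Let $\sigma_{d+1}=2^{[d+2]}$ be the full simplex on vertex set $[d+2]=\{1<2<\dots<d+2\}$ and $\Delta=\partial(\sigma_{d+1})=\sigma_{d+1}\setminus\{[d+2]\}$ its boundary, a $d$-dimensional simplicial complex. The simplicial boundary map $\partial_d$ is $\partial_d(e_\sigma)=\sum_{k=1}^{d+1}(-1)^{k-1}e_{\sigma\setminus\{j_k\}}$ for a $d$-face $\sigma=\{j_1<\dots<j_{d+1}\}$, and the $d$-th Laplacian matrix is $\mathcal{L}_d(\Delta)=\partial_d^{\top}\partial_d\in\mathbb{Z}^{(d+2)\times(d+2)}$ (as $\partial_{d+1}=0$), with rows and columns ordered according to the facets $F_1,\dots,F_{d+2}$, $F_i=[d+2]\setminus\{d+3-i\}$. For $d$ even, $\widetilde{P}_{\partial(\sigma_{d+1})}\subseteq\mathbb{R}^d$ is the convex hull of the columns of the $d\times(d+2)$-matrix obtained from $\mathcal{L}_d(\Delta)$ by deleting its first two rows. The interior polytope $Q_{\partial(\sigma_{d+1})}$ is the convex hull of all lattice points (points of $\mathbb{Z}^d$) in the interior of $\widetilde{P}_{\partial(\sigma_{d+1})}$. A lattice polytope $P\subseteq\mathbb{R}^d$ is reflexive if $P=\{x\in\mathbb{R}^d: Ax\le\mathds{1}\}$ for some integral matrix $A$ (where here $\mathds{1}$ is the all-ones vector of the appropriate length). *)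

theory Defs
  imports "HOL-Analysis.Analysis"
begin

text \<open>
  The \<open>k\<close>-dimensional faces of a complex \<open>K\<close>, given as a set of finite sets of naturals, are its
  members with \<open>k + 1\<close> elements; the parameter of \<open>faces\<close> is that number of elements, so that
  dimension \<open>-1\<close> needs no special treatment.
\<close>
definition faces :: "nat set set \<Rightarrow> nat \<Rightarrow> nat set set" where
  "faces K m = {\<sigma> \<in> K. card \<sigma> = m}"

definition simplex_boundary :: "nat \<Rightarrow> nat set set" where
  "simplex_boundary d = Pow {1..d + 2} - {{1..d + 2}}"

text \<open>
  The coefficient of \<open>e\<^sub>\<tau>\<close> in the boundary of \<open>e\<^sub>\<sigma>\<close>: with \<open>\<sigma> = {j\<^sub>1 < ... < j\<^sub>m}\<close>, the vertex \<open>j\<^sub>k\<close>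
  is entry \<open>k - 1\<close> of the increasing enumeration of \<open>\<sigma>\<close>.
\<close>
definition boundary_coeff :: "nat set \<Rightarrow> nat set \<Rightarrow> int" where
  "boundary_coeff \<tau> \<sigma> =
     (\<Sum>k = 1..card \<sigma>. if \<tau> = \<sigma> - {sorted_list_of_set \<sigma> ! (k - 1)} then (- 1) ^ (k - 1) else 0)"

definition facet :: "nat \<Rightarrow> nat \<Rightarrow> nat set" where
  "facet d i = {1..d + 2} - {d + 3 - i}"

text \<open>
  The entry in row \<open>i\<close> and column \<open>j\<close> (\<open>1 \<le> i, j \<le> d + 2\<close>) of the transpose of \<open>\<partial>\<^sub>d\<close> times \<open>\<partial>\<^sub>d\<close>;
  the summation runs over the \<open>(d - 1)\<close>-dimensional faces.
\<close>
definition laplacian :: "nat \<Rightarrow> nat \<Rightarrow> nat \<Rightarrow> int" where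
  "laplacian d i j =
     (\<Sum>\<tau> \<in> faces (simplex_boundary d) d.
        boundary_coeff \<tau> (facet d i) * boundary_coeff \<tau> (facet d j))"

text \<open>
  The space of real vectors with coordinates \<open>1, ..., d\<close> is rendered as \<open>real ^ 'n\<close> together with a
  bijection \<open>v\<close> from \<open>{1..d}\<close> onto the index type \<open>'n\<close>; the \<open>k\<close>-th coordinate of \<open>x\<close> is \<open>x $ v k\<close>.
  In \<open>column d v j\<close>, coordinate \<open>k\<close> is the Laplacian entry in row \<open>k + 2\<close>, the first two rows
  being deleted.
\<close>
definition column :: "nat \<Rightarrow> (nat \<Rightarrow> 'n::finite) \<Rightarrow> nat \<Rightarrow> real ^ 'n" where
  "column d v j = (\<chi> c. real_of_int (laplacian d (inv_into {1..d} v c + 2) j))"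

definition P_tilde :: "nat \<Rightarrow> (nat \<Rightarrow> 'n::finite) \<Rightarrow> (real ^ 'n) set" where
  "P_tilde d v = convex hull (column d v ` {1..d + 2})"

definition lattice_points :: "(real ^ 'n::finite) set" where
  "lattice_points = {x. \<forall>c. x $ c \<in> \<int>}"

definition interior_polytope :: "(real ^ 'n::finite) set \<Rightarrow> (real ^ 'n) set" where
  "interior_polytope P = convex hull (interior P \<inter> lattice_points)"

definition lattice_polytope :: "(real ^ 'n::finite) set \<Rightarrow> bool" where
  "lattice_polytope P \<longleftrightarrow> (\<exists>V. finite V \<and> V \<subseteq> lattice_points \<and> P = convex hull V)"

text \<open>The vectors \<open>A 0, ..., A (m - 1)\<close> are the rows of the integral matrix.\<close>
definition reflexive :: "(real ^ 'n::finite) set \<Rightarrow> bool" where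
  "reflexive P \<longleftrightarrow> lattice_polytope P \<and>
     (\<exists>(m::nat) (A :: nat \<Rightarrow> real ^ 'n).
        (\<forall>i<m. A i \<in> lattice_points) \<and> P = {x. \<forall>i<m. A i \<bullet> x \<le> 1})"

text \<open>
  The family of inequalities \<open>f i x \<le> b i\<close>, for \<open>i \<in> I\<close>, describes \<open>P\<close> (first conjunct), none of
  its members can be omitted (second conjunct), and its members correspond one-to-one to the facets
  of \<open>P\<close> (third conjunct).
\<close>
definition facet_description ::
  "'a::euclidean_space set \<Rightarrow> 'i set \<Rightarrow> ('i \<Rightarrow> 'a \<Rightarrow> real) \<Rightarrow> ('i \<Rightarrow> real) \<Rightarrow> bool" where
  "facet_description P I f b \<longleftrightarrow>
     P = {x. \<forall>i\<in>I. f i x \<le> b i} \<and>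
     (\<forall>k\<in>I. P \<noteq> {x. \<forall>i\<in>I - {k}. f i x \<le> b i}) \<and>
     bij_betw (\<lambda>i. {x \<in> P. f i x = b i}) I {F. F facet_of P}"

datatype ineq = Total | Even nat | Odd nat | Pair nat nat

definition ineqs :: "nat \<Rightarrow> ineq set" where
  "ineqs d = {Total} \<union> {Even i |i. i \<in> {1..d} \<and> even i} \<union> {Odd j |j. j \<in> {1..d} \<and> odd j}
     \<union> {Pair i j |i j. 1 \<le> i \<and> i < j \<and> j \<le> d \<and> odd (i + j)}"

text \<open>The last inequality, \<open>x\<^sub>i + x\<^sub>j \<ge> 1\<close>, is negated to fit the form \<open>f x \<le> b\<close>.\<close>
fun ineq_lhs :: "nat \<Rightarrow> (nat \<Rightarrow> 'n::finite) \<Rightarrow> ineq \<Rightarrow> real ^ 'n \<Rightarrow> real" where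
  "ineq_lhs d v Total x = (\<Sum>k\<in>{1..d}. x $ v k)"
| "ineq_lhs d v (Even i) x = (\<Sum>k\<in>{k\<in>{1..d}. odd k}. x $ v k) - x $ v i"
| "ineq_lhs d v (Odd j) x = (\<Sum>k\<in>{k\<in>{1..d}. even k}. x $ v k) - x $ v j"
| "ineq_lhs d v (Pair i j) x = - (x $ v i + x $ v j)"

fun ineq_rhs :: "nat \<Rightarrow> ineq \<Rightarrow> real" where
  "ineq_rhs d Total = real d + 1"
| "ineq_rhs d (Even i) = real d / 2"
| "ineq_rhs d (Odd j) = real d / 2"
| "ineq_rhs d (Pair i j) = - 1"

abbreviation all_ones :: "real ^ 'n::finite" where
  "all_ones \<equiv> (\<chi> c. 1)"

end

theory Submission
  imports Defs
begin

text \<open>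
  With \<open>s = (-1, 1, -1, 1, ...)\<close>, the Laplacian is \<open>(d + 2) I - s s\<^sup>T\<close>. After deleting two rows and
  translating by \<open>- \<one>\<close>, its odd and even columns become the vertices of two simplices of dimension
  \<open>d / 2\<close> with barycentre \<open>0\<close> in the two complementary coordinate subspaces, each of them twice the
  reflexive simplex \<open>y\<^sub>i \<ge> -1, \<Sum> y\<^sub>i \<le> 1\<close>. So the translate of \<open>P\<close> is \<open>2 H\<close>, where \<open>H\<close> is the free sum of
  the two reflexive simplices; its facets are the sums of one facet inequality of each summand. The
  facet normals of \<open>H\<close> are integral with right-hand side \<open>1\<close>, so the lattice points interior to
  \<open>2 H\<close> are exactly those of \<open>H\<close>, and \<open>H\<close> is spanned by its lattice points.
\<close>

section \<open>The Laplacian of the boundary of a simplex\<close>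

lemma sorted_list_of_set_atLeastAtMost_remove:
  assumes "a \<in> {1..n + 1}"
  shows "sorted_list_of_set ({1..n + 1} - {a}) = [1..<a] @ [a + 1..<n + 2]"
  by (rule sorted_list_of_set_unique[THEN iffD1]) (use assms in \<open>auto simp: sorted_wrt_append simp del: upt_Suc\<close>)

text \<open>The sign of the vertex \<open>x\<close> in the boundary of the facet missing
  \<open>a\<close>: its position is \<open>x\<close> if \<open>x < a\<close> and
  \<open>x - 1\<close> otherwise, since the missing vertex shifts all larger ones down by
  one.\<close>

definition incidence_sign :: "nat \<Rightarrow> nat \<Rightarrow> int" where
  "incidence_sign a x = (if x < a then - ((- 1) ^ x) else (- 1) ^ x)"

lemma boundary_coeff_remove:
  assumes "a \<in> {1..n + 1}"
  shows "boundary_coeff \<tau> ({1..n + 1} - {a}) =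
    (\<Sum>x\<in>{1..n + 1} - {a}. if \<tau> = {1..n + 1} - {a} - {x} then incidence_sign a x else 0)"
proof -
  \<comment> \<open>\<open>?g k\<close> is the \<open>k\<close>-th smallest vertex other than
    \<open>a\<close>; reindexing along it replaces positions by vertices.\<close>
  let ?g = "\<lambda>k. if k < a then k else k + 1"
  have nth: "sorted_list_of_set ({1..n + 1} - {a}) ! (k - 1) = ?g k" if "k \<in> {1..n}" for k
    using that assms unfolding sorted_list_of_set_atLeastAtMost_remove[OF assms]
    by (auto simp: nth_append)
  have bij: "bij_betw ?g {1..n} ({1..n + 1} - {a})"
    by (rule bij_betwI[where g = "\<lambda>x. if x < a then x else x - 1"]) (use assms in \<open>auto split: if_splits\<close>)
  have sgn: "(- 1) ^ (k - 1) = incidence_sign a (?g k)" if "k \<in> {1..n}" for k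
    using that by (cases k) (auto simp: incidence_sign_def)
  have card: "card ({1..n + 1} - {a}) = n"
    using assms by simp
  show ?thesis
    unfolding boundary_coeff_def card sum.reindex_bij_betw[OF bij, symmetric]
    by (rule sum.cong[OF refl]) (simp only: nth sgn)
qed

lemma boundary_coeff_remove2:
  assumes "a \<in> {1..n + 1}" "x \<in> {1..n + 1} - {a}"
  shows "boundary_coeff ({1..n + 1} - {a} - {x}) ({1..n + 1} - {a}) = incidence_sign a x"
proof -
  have "({1..n + 1} - {a} - {x} = {1..n + 1} - {a} - {y}) \<longleftrightarrow> x = y"
    if "y \<in> {1..n + 1} - {a}" for y
    using assms that by blast
  then show ?thesis
    unfolding boundary_coeff_remove[OF assms(1)]
    using assms(2) by (subst sum.cong[OF refl, where h = "\<lambda>y. if x = y then incidence_sign a y else 0"]) auto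
qed

text \<open>A ridge lies in both facets only if it misses \<open>a\<close> and \<open>b\<close>, so
  two distinct facets share exactly one ridge.\<close>

lemma boundary_coeff_other:
  assumes "a \<in> {1..n + 1}" "b \<in> {1..n + 1}" "a \<noteq> b" "x \<in> {1..n + 1} - {a}"
  shows "boundary_coeff ({1..n + 1} - {a} - {x}) ({1..n + 1} - {b}) =
    (if x = b then incidence_sign b a else 0)"
proof (cases "x = b")
  case True
  then have eq: "{1..n + 1} - {a} - {x} = {1..n + 1} - {b} - {a}"
    by blast
  show ?thesis
    unfolding eq using boundary_coeff_remove2[OF assms(2), of a] assms True by simp
next
  case False
  then have "{1..n + 1} - {a} - {x} \<noteq> {1..n + 1} - {b} - {y}" for y
    using assms by blast
  then show ?thesis
    unfolding boundary_coeff_remove[OF assms(2)] using False by simp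
qed

text \<open>On the diagonal, each of the \<open>d + 1\<close> ridges of a facet contributes a
  squared sign. Off the diagonal, only the single common ridge of the two facets
  contributes.\<close>

lemma laplacian_eq:
  assumes "i \<in> {1..d + 2}" "j \<in> {1..d + 2}"
  shows "laplacian d i j = (if i = j then int d + 1 else - ((- 1) ^ (i + j)))"
proof -
  define a b where "a = d + 3 - i" and "b = d + 3 - j"
  define U where "U = {1..d + 1 + 1}"
  have U: "{1..d + 2} = U" and finU: "finite U" and cardU: "card U = d + 2"
    by (simp_all add: U_def)
  have ab: "a \<in> U" "b \<in> U"
    using assms by (auto simp: a_def b_def U_def)
  let ?Y = "faces (simplex_boundary d) d"
  have "finite ?Y"
    by (simp add: faces_def simplex_boundary_def)
  have face: "U - {a} - {x} \<in> ?Y" if "x \<in> U - {a}" for x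
  proof -
    have "card (U - {a} - {x}) = d"
      using ab that finU cardU by simp
    then show ?thesis
      using ab(1) unfolding faces_def simplex_boundary_def U by auto
  qed
  have "laplacian d i j = (\<Sum>\<tau>\<in>?Y. boundary_coeff \<tau> (U - {a}) * boundary_coeff \<tau> (U - {b}))"
    unfolding laplacian_def facet_def U a_def b_def ..
  \<comment> \<open>Expanding the first factor and swapping the sums lets each removed vertex
    \<open>x\<close> select its own ridge.\<close>
  also have "\<dots> = (\<Sum>\<tau>\<in>?Y. \<Sum>x\<in>U - {a}.
      if \<tau> = U - {a} - {x} then incidence_sign a x * boundary_coeff \<tau> (U - {b}) else 0)"
    unfolding boundary_coeff_remove[OF ab(1)[unfolded U_def], folded U_def] sum_distrib_right
    by (intro sum.cong refl) auto
  also have "\<dots> = (\<Sum>x\<in>U - {a}. \<Sum>\<tau>\<in>?Y.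
      if \<tau> = U - {a} - {x} then incidence_sign a x * boundary_coeff \<tau> (U - {b}) else 0)"
    by (rule sum.swap)
  also have "\<dots> = (\<Sum>x\<in>U - {a}. incidence_sign a x * boundary_coeff (U - {a} - {x}) (U - {b}))"
    using face \<open>finite ?Y\<close> by (intro sum.cong refl) (simp add: sum.delta)
  also have "\<dots> = (if i = j then int d + 1 else - ((- 1) ^ (i + j)))"
  proof (cases "i = j")
    case True
    have "incidence_sign a x * boundary_coeff (U - {a} - {x}) (U - {b}) = 1" if "x \<in> U - {a}" for x
    proof -
      have "b = a"
        using True by (simp add: a_def b_def)
      then have "boundary_coeff (U - {a} - {x}) (U - {b}) = incidence_sign a x"
        using boundary_coeff_remove2[of a "d + 1" x] ab that unfolding U_def by simp
      then show ?thesis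
        by (auto simp: incidence_sign_def simp flip: power_add)
    qed
    then have "(\<Sum>x\<in>U - {a}. incidence_sign a x * boundary_coeff (U - {a} - {x}) (U - {b}))
        = int (card (U - {a}))"
      by simp
    then show ?thesis
      using True ab finU cardU by simp
  next
    case False
    then have "a \<noteq> b"
      using assms by (auto simp: a_def b_def)
    have "(\<Sum>x\<in>U - {a}. incidence_sign a x * boundary_coeff (U - {a} - {x}) (U - {b}))
        = (\<Sum>x\<in>U - {a}. if x = b then incidence_sign a b * incidence_sign b a else 0)"
      using boundary_coeff_other[of a "d + 1" b] ab \<open>a \<noteq> b\<close> unfolding U_def
      by (intro sum.cong refl) auto
    also have "\<dots> = incidence_sign a b * incidence_sign b a"
      using ab \<open>a \<noteq> b\<close> finU by simp
    \<comment> \<open>Exactly one of \<open>a < b\<close> and \<open>b < a\<close> holds, so exactly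
      one factor carries the extra minus sign.\<close>
    also have "\<dots> = - ((- 1) ^ (a + b))"
      using \<open>a \<noteq> b\<close> by (auto simp: incidence_sign_def power_add)
    also have "even (a + b) \<longleftrightarrow> even (i + j)"
      using assms by (auto simp: a_def b_def)
    then have "(- 1 :: int) ^ (a + b) = (- 1) ^ (i + j)"
      by (simp add: minus_one_power_iff)
    finally show ?thesis
      using False by simp
  qed
  finally show ?thesis .
qed

section \<open>Irredundant systems of linear inequalities\<close>

text \<open>Normals must be nonzero: the inequality \<open>0 \<le> 0\<close> holds everywhere, its
  strict version nowhere.\<close>

lemma interior_halfspaces:
  fixes a :: "'i \<Rightarrow> 'a::euclidean_space"
  assumes "finite I" "\<And>i. i \<in> I \<Longrightarrow> a i \<noteq> 0"
  shows "interior {x. \<forall>i\<in>I. a i \<bullet> x \<le> b i} = {x. \<forall>i\<in>I. a i \<bullet> x < b i}"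
proof (intro equalityI subsetI)
  fix x assume x: "x \<in> interior {x. \<forall>i\<in>I. a i \<bullet> x \<le> b i}"
  have "x \<in> interior {x. a i \<bullet> x \<le> b i}" if "i \<in> I" for i
    using x that interior_mono[of "{x. \<forall>i\<in>I. a i \<bullet> x \<le> b i}" "{x. a i \<bullet> x \<le> b i}"] by blast
  then show "x \<in> {x. \<forall>i\<in>I. a i \<bullet> x < b i}"
    using assms(2) by auto
next
  fix x assume x: "x \<in> {x. \<forall>i\<in>I. a i \<bullet> x < b i}"
  have "open (\<Inter>i\<in>I. {x. a i \<bullet> x < b i})"
    using assms(1) by (intro open_INT ballI open_halfspace_lt)
  moreover have "(\<Inter>i\<in>I. {x. a i \<bullet> x < b i}) \<subseteq> {x. \<forall>i\<in>I. a i \<bullet> x \<le> b i}"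
    by force
  ultimately show "x \<in> interior {x. \<forall>i\<in>I. a i \<bullet> x \<le> b i}"
    using x by (intro interiorI) auto
qed

text \<open>The strictly feasible point \<open>c\<close> makes the polyhedron full-dimensional, and
  each \<open>outer\<close> point violates exactly one inequality. Hence the halfspaces form a
  minimal family, whose bounding hyperplanes cut out precisely the facets.\<close>

lemma facet_description_irredundant:
  fixes a :: "'i \<Rightarrow> 'a::euclidean_space"
  assumes fin: "finite I"
    and inner: "\<And>i. i \<in> I \<Longrightarrow> a i \<bullet> c < b i"
    and outer: "\<And>k. k \<in> I \<Longrightarrow> \<exists>x. b k < a k \<bullet> x \<and> (\<forall>i\<in>I - {k}. a i \<bullet> x \<le> b i)"
  shows "facet_description {x. \<forall>i\<in>I. a i \<bullet> x \<le> b i} I (\<lambda>i x. a i \<bullet> x) b"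
proof -
  let ?P = "{x. \<forall>i\<in>I. a i \<bullet> x \<le> b i}"
  let ?H = "\<lambda>i. {x. a i \<bullet> x \<le> b i}"
  have nz: "a i \<noteq> 0" if "i \<in> I" for i
    using inner[OF that] outer[OF that] by force
  have irr: "?P \<noteq> {x. \<forall>i\<in>I - {k}. a i \<bullet> x \<le> b i}" if "k \<in> I" for k
  proof -
    obtain x where "b k < a k \<bullet> x" "\<forall>i\<in>I - {k}. a i \<bullet> x \<le> b i"
      using outer[OF \<open>k \<in> I\<close>] by blast
    then have "x \<in> {x. \<forall>i\<in>I - {k}. a i \<bullet> x \<le> b i}" "x \<notin> ?P"
      using \<open>k \<in> I\<close> by force+
    then show ?thesis
      by blast
  qed
  have "c \<in> interior ?P"
    using interior_halfspaces[OF fin nz] inner by auto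
  then have aff: "affine hull ?P = UNIV"
    by (intro affine_hull_nonempty_interior) auto
  have injH: "inj_on ?H I"
  proof (rule inj_onI, rule ccontr)
    fix i j assume ij: "i \<in> I" "j \<in> I" "?H i = ?H j" "i \<noteq> j"
    obtain x where "b i < a i \<bullet> x" "\<forall>k\<in>I - {i}. a k \<bullet> x \<le> b k"
      using outer[OF ij(1)] by blast
    then have "x \<in> ?H j" "x \<notin> ?H i"
      using ij(2,4) by auto
    then show False
      using ij(3) by simp
  qed
  \<comment> \<open>\<open>facet_of_polyhedron_explicit\<close> takes a set of halfspaces instead of
    an indexed family; \<open>n\<close> recovers the index of a halfspace, and with it the normal
    and the bound.\<close>
  define n where "n = the_inv_into I ?H"
  have n: "n (?H i) = i" if "i \<in> I" for i
    unfolding n_def using the_inv_into_f_f[OF injH that] .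
  have facets: "C facet_of ?P \<longleftrightarrow>
      (\<exists>h. h \<in> ?H ` I \<and> C = ?P \<inter> {x. a (n h) \<bullet> x = b (n h)})" for C
  proof (rule facet_of_polyhedron_explicit)
    show "finite (?H ` I)"
      using fin by simp
    show "?P = affine hull ?P \<inter> \<Inter> (?H ` I)"
      unfolding aff by auto
    show "a (n h) \<noteq> 0 \<and> h = {x. a (n h) \<bullet> x \<le> b (n h)}" if "h \<in> ?H ` I" for h
      using that n nz by auto
    show "?P \<subset> affine hull ?P \<inter> \<Inter> F'" if F': "F' \<subset> ?H ` I" for F'
    proof -
      obtain k where k: "k \<in> I" "?H k \<notin> F'"
        using F' by blast
      obtain x where x: "b k < a k \<bullet> x" "\<forall>i\<in>I - {k}. a i \<bullet> x \<le> b i"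
        using outer[OF k(1)] by blast
      have "x \<in> \<Inter> F'"
      proof
        fix h assume "h \<in> F'"
        then obtain i where "i \<in> I" "h = ?H i" "i \<noteq> k"
          using F' k(2) by blast
        then show "x \<in> h"
          using x(2) by auto
      qed
      moreover have "x \<notin> ?P"
        using x(1) k(1) by force
      moreover have "?P \<subseteq> \<Inter> F'"
        using F' by blast
      ultimately show ?thesis
        unfolding aff by blast
    qed
  qed
  have inj: "inj_on (\<lambda>i. {x \<in> ?P. a i \<bullet> x = b i}) I"
  proof (rule inj_onI, rule ccontr)
    fix i j assume ij: "i \<in> I" "j \<in> I" "{x \<in> ?P. a i \<bullet> x = b i} = {x \<in> ?P. a j \<bullet> x = b j}" "i \<noteq> j"
    obtain x where x: "b i < a i \<bullet> x" "\<forall>k\<in>I - {i}. a k \<bullet> x \<le> b k"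
      using outer[OF ij(1)] by blast
    \<comment> \<open>the point of the segment from \<open>c\<close> to \<open>x\<close> on the \<open>i\<close>-th hyperplane is strictly inside the others\<close>
    define t where "t = (b i - a i \<bullet> c) / (a i \<bullet> x - a i \<bullet> c)"
    define y where "y = (1 - t) *\<^sub>R c + t *\<^sub>R x"
    have t: "0 < t" "t < 1"
      using x(1) inner[OF ij(1)] by (auto simp: t_def field_simps)
    have "a i \<bullet> y = a i \<bullet> c + t * (a i \<bullet> x - a i \<bullet> c)"
      by (simp add: y_def inner_add_right algebra_simps)
    then have yi: "a i \<bullet> y = b i"
      using x(1) inner[OF ij(1)] by (simp add: t_def)
    have yk: "a k \<bullet> y < b k" if "k \<in> I" "k \<noteq> i" for k
    proof -
      have "(1 - t) * (a k \<bullet> c) + t * (a k \<bullet> x) < (1 - t) * b k + t * b k"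
        using t inner[OF that(1)] x(2) that by (intro add_less_le_mono) auto
      then show ?thesis
        by (simp add: y_def inner_add_right algebra_simps)
    qed
    have "y \<in> {x \<in> ?P. a i \<bullet> x = b i}"
      using yi yk by force
    then have "a j \<bullet> y = b j"
      using ij(3) by blast
    then show False
      using yk[OF ij(2)] ij(4) by simp
  qed
  have img: "(\<lambda>i. {x \<in> ?P. a i \<bullet> x = b i}) ` I = {F. F facet_of ?P}"
  proof -
    have "{F. F facet_of ?P} = (\<lambda>h. ?P \<inter> {x. a (n h) \<bullet> x = b (n h)}) ` ?H ` I"
      unfolding image_def[where A = "?H ` I"] facets by blast
    also have "\<dots> = (\<lambda>i. {x \<in> ?P. a i \<bullet> x = b i}) ` I"
      unfolding image_image by (intro image_cong refl) (auto simp: n)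
    finally show ?thesis ..
  qed
  show ?thesis
    unfolding facet_description_def bij_betw_def using irr inj img by blast
qed

section \<open>Free sums of two simplices\<close>

text \<open>
  The points \<open>p j\<close>, for \<open>j \<in> A\<close> and for \<open>j \<in> B\<close>, are the vertices of two simplices with
  barycentre \<open>0\<close> in complementary subspaces. The functional \<open>\<alpha> i\<close> is \<open>1\<close> on the facet opposite to
  \<open>p i\<close> and vanishes on the other subspace.
\<close>
locale free_sum =
  fixes A B :: "'i set" and p \<alpha> :: "'i \<Rightarrow> 'a::euclidean_space" and m :: nat
  assumes finite: "finite A" "finite B" and disjoint: "A \<inter> B = {}"
    and card: "card A = m" "card B = m" and m_gt_1: "m > 1"
    and pairing: "\<And>i j. i \<in> A \<union> B \<Longrightarrow> j \<in> A \<union> B \<Longrightarrow>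
      \<alpha> i \<bullet> p j = (if i = j then 1 - real m else if (i \<in> A) = (j \<in> A) then 1 else 0)"
    and expansion: "\<And>x. x = - (\<Sum>j\<in>A \<union> B. ((\<alpha> j \<bullet> x) / m) *\<^sub>R p j)"
begin

lemma eq_0I:
  assumes "\<And>i. i \<in> A \<union> B \<Longrightarrow> \<alpha> i \<bullet> x = 0"
  shows "x = 0"
  using expansion[of x] assms by simp

text \<open>The form constant minus delta makes a sum over one side evaluate to
  \<open>m - m = 0\<close>.\<close>

lemma pairing_same_side:
  assumes "S = A \<or> S = B" "i \<in> S" "j \<in> S"
  shows "\<alpha> i \<bullet> p j = 1 - (if i = j then real m else 0)"
  using pairing[of i j] assms disjoint by auto

lemma pairing_other_side:
  assumes "S = A \<or> S = B" "i \<in> A \<union> B" "i \<notin> S" "j \<in> S"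
  shows "\<alpha> i \<bullet> p j = 0"
  using pairing[of i j] assms disjoint by auto

lemma sum_vertices:
  assumes "S = A \<or> S = B"
  shows "(\<Sum>j\<in>S. p j) = 0"
proof (rule eq_0I)
  fix i assume i: "i \<in> A \<union> B"
  have S: "finite S" "card S = m"
    using assms finite card by auto
  show "\<alpha> i \<bullet> (\<Sum>j\<in>S. p j) = 0"
  proof (cases "i \<in> S")
    case True
    then have "\<alpha> i \<bullet> (\<Sum>j\<in>S. p j) = (\<Sum>j\<in>S. 1 - (if i = j then real m else 0))"
      unfolding inner_sum_right using pairing_same_side[OF assms] by (intro sum.cong) auto
    then show ?thesis
      using True S by (simp add: sum_subtractf)
  next
    case False
    then show ?thesis
      unfolding inner_sum_right using pairing_other_side[OF assms i] by simp
  qed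
qed

text \<open>The sum of the functionals of one side vanishes at every \<open>p j\<close>, and by
  \<open>expansion\<close> these points span the space.\<close>

lemma sum_functionals:
  assumes "S = A \<or> S = B"
  shows "(\<Sum>i\<in>S. \<alpha> i \<bullet> x) = 0"
proof -
  have S: "finite S" "card S = m"
    using assms finite card by auto
  have "(\<Sum>i\<in>S. \<alpha> i) \<bullet> p j = 0" if j: "j \<in> A \<union> B" for j
  proof (cases "j \<in> S")
    case True
    then have "(\<Sum>i\<in>S. \<alpha> i) \<bullet> p j = (\<Sum>i\<in>S. 1 - (if i = j then real m else 0))"
      unfolding inner_sum_left using pairing_same_side[OF assms] by (intro sum.cong) auto
    then show ?thesis
      using True S by (simp add: sum_subtractf)
  next
    case False
    have "\<alpha> i \<bullet> p j = 0" if "i \<in> S" for i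
      using pairing[of i j] that j False assms disjoint by auto
    then show ?thesis
      unfolding inner_sum_left by simp
  qed
  then have "(\<Sum>i\<in>S. \<alpha> i) \<bullet> - (\<Sum>j\<in>A \<union> B. ((\<alpha> j \<bullet> x) / m) *\<^sub>R p j) = 0"
    by (simp add: inner_sum_right)
  then show ?thesis
    unfolding expansion[of x, symmetric] inner_sum_left .
qed

text \<open>Summing over one side for a fixed \<open>i\<close> on the other cancels everything but
  \<open>m\<close> times \<open>\<alpha> i \<bullet> x\<close>, which is therefore nonpositive.
  Nonpositive numbers with sum 0 all vanish.\<close>

lemma nonpos_imp_0:
  assumes "\<And>a b. a \<in> A \<Longrightarrow> b \<in> B \<Longrightarrow> (\<alpha> a + \<alpha> b) \<bullet> x \<le> 0"
  shows "x = 0"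
proof (rule eq_0I)
  have *: "\<forall>i\<in>S. \<alpha> i \<bullet> x = 0"
    if S: "S = A \<and> T = B \<or> S = B \<and> T = A" for S T
  proof -
    have fin: "finite S" and cT: "card T = m"
      using S finite card by auto
    have "\<alpha> i \<bullet> x \<le> 0" if "i \<in> S" for i
    proof -
      have "(\<Sum>j\<in>T. \<alpha> i \<bullet> x + \<alpha> j \<bullet> x) \<le> 0"
      proof (rule sum_nonpos)
        fix j assume "j \<in> T"
        then show "\<alpha> i \<bullet> x + \<alpha> j \<bullet> x \<le> 0"
          using S assms[of i j] assms[of j i] \<open>i \<in> S\<close> by (auto simp: inner_add_left)
      qed
      then have "real m * (\<alpha> i \<bullet> x) \<le> 0"
        using sum_functionals[of T x] S cT by (auto simp: sum.distrib)
      then show ?thesis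
        using m_gt_1 by (simp add: mult_le_0_iff)
    qed
    moreover have "(\<Sum>i\<in>S. \<alpha> i \<bullet> x) = 0"
      using sum_functionals S by auto
    ultimately show ?thesis
      using fin sum_nonneg_eq_0_iff[of S "\<lambda>i. - (\<alpha> i \<bullet> x)"] by (auto simp: sum_negf)
  qed
  show "\<alpha> i \<bullet> x = 0" if "i \<in> A \<union> B" for i
    using *[of A B] *[of B A] that by blast
qed

text \<open>For the inclusion from right to left, start from the coefficients
  \<open>- (\<alpha> j \<bullet> x) / m\<close> of \<open>expansion\<close>. Since the vertices of
  each side sum to 0, a constant may be added to all coefficients of that side; the maxima
  \<open>g\<close> and \<open>h\<close>, divided by \<open>m\<close>, make them nonnegative with
  total \<open>g + h\<close>.\<close>

lemma convex_hull_vertices: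
  "convex hull (p ` (A \<union> B)) = {x. \<forall>a\<in>A. \<forall>b\<in>B. (\<alpha> a + \<alpha> b) \<bullet> x \<le> 1}" (is "_ = ?P")
proof
  have "?P = (\<Inter>a\<in>A. \<Inter>b\<in>B. {x. (\<alpha> a + \<alpha> b) \<bullet> x \<le> 1})"
    by auto
  moreover have "convex \<dots>"
    by (intro convex_INT convex_halfspace_le)
  moreover have "p ` (A \<union> B) \<subseteq> ?P"
  proof clarify
    fix j a b assume "j \<in> A \<union> B" "a \<in> A" "b \<in> B"
    then show "(\<alpha> a + \<alpha> b) \<bullet> p j \<le> 1"
      using pairing[of a j] pairing[of b j] disjoint by (auto simp: inner_add_left)
  qed
  ultimately show "convex hull (p ` (A \<union> B)) \<subseteq> ?P"
    by (metis (no_types, lifting) hull_minimal)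
next
  show "?P \<subseteq> convex hull (p ` (A \<union> B))"
  proof
    fix x assume x: "x \<in> ?P"
    have ne: "A \<noteq> {}" "B \<noteq> {}"
      using card m_gt_1 by auto
    define g h where "g = Max ((\<lambda>a. \<alpha> a \<bullet> x) ` A)" and "h = Max ((\<lambda>b. \<alpha> b \<bullet> x) ` B)"
    have g: "\<alpha> a \<bullet> x \<le> g" if "a \<in> A" for a
      using that finite by (simp add: g_def)
    have h: "\<alpha> b \<bullet> x \<le> h" if "b \<in> B" for b
      using that finite by (simp add: h_def)
    \<comment> \<open>Both maxima are attained, so the inequality of a maximizing pair reads
      \<open>g + h \<le> 1\<close>.\<close>
    have "g \<in> (\<lambda>a. \<alpha> a \<bullet> x) ` A" "h \<in> (\<lambda>b. \<alpha> b \<bullet> x) ` B"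
      unfolding g_def h_def using finite ne by (auto intro!: Max_in)
    then have gh: "g + h \<le> 1"
      using x by (auto simp: inner_add_left)
    \<comment> \<open>barycentric coordinates, with the slack \<open>1 - (g + h)\<close> spread evenly over all vertices\<close>
    define u where "u j = ((if j \<in> A then g else h) - \<alpha> j \<bullet> x) / m + (1 - (g + h)) / (2 * m)" for j
    have uA: "u j = (g - \<alpha> j \<bullet> x) / m + (1 - (g + h)) / (2 * m)" if "j \<in> A" for j
      using that by (simp add: u_def)
    have uB: "u j = (h - \<alpha> j \<bullet> x) / m + (1 - (g + h)) / (2 * m)" if "j \<in> B" for j
      using that disjoint by (auto simp: u_def)
    have u0: "0 \<le> u j" if "j \<in> A \<union> B" for j
      using that g h gh by (auto simp: u_def)
    have "(\<Sum>j\<in>S. (c - \<alpha> j \<bullet> x) / m + e / (2 * m)) = c + e / 2"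
      if "S = A \<or> S = B" for S c e
      using that sum_functionals[OF that, of x] card m_gt_1
      by (auto simp: sum.distrib sum_subtractf simp flip: sum_divide_distrib)
    then have "(\<Sum>j\<in>A. u j) = g + (1 - (g + h)) / 2" "(\<Sum>j\<in>B. u j) = h + (1 - (g + h)) / 2"
      by (simp_all add: uA uB)
    then have u1: "(\<Sum>j\<in>A \<union> B. u j) = 1"
      using finite disjoint by (simp add: sum.union_disjoint field_simps)
    have side: "(\<Sum>j\<in>S. u j *\<^sub>R p j) = - (\<Sum>j\<in>S. ((\<alpha> j \<bullet> x) / m) *\<^sub>R p j)"
      if S: "S = A \<or> S = B" and eq: "\<And>j. j \<in> S \<Longrightarrow> u j = (c - \<alpha> j \<bullet> x) / m + e" for S c e
    proof -
      have "u j *\<^sub>R p j = (c / m + e) *\<^sub>R p j - ((\<alpha> j \<bullet> x) / m) *\<^sub>R p j" if "j \<in> S" for j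
        unfolding eq[OF that] by (simp add: diff_divide_distrib algebra_simps)
      then show ?thesis
        using sum_vertices[OF S] by (simp add: sum_subtractf flip: scaleR_sum_right)
    qed
    have "(\<Sum>j\<in>A \<union> B. u j *\<^sub>R p j) = - (\<Sum>j\<in>A \<union> B. ((\<alpha> j \<bullet> x) / m) *\<^sub>R p j)"
      using side[OF _ uA] side[OF _ uB] finite disjoint by (simp add: sum.union_disjoint)
    also have "\<dots> = x"
      using expansion[of x] by simp
    finally have "x = (\<Sum>j\<in>A \<union> B. u j *\<^sub>R p j)" ..
    also have "\<dots> \<in> convex hull (p ` (A \<union> B))"
      using finite u0 u1 by (intro convex_sum convex_convex_hull) (auto intro: hull_inc)
    finally show "x \<in> convex hull (p ` (A \<union> B))" .
  qed
qed

text \<open>A negative multiple of \<open>p a + p b\<close> works: scaled by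
  \<open>1 / (m - 1)\<close>, it gives \<open>\<alpha> a\<close> and \<open>\<alpha> b\<close> the
  value 1 and every other functional the negative value \<open>c\<close>, so only the pair
  \<open>(a, b)\<close> exceeds 1.\<close>

lemma outer_point:
  assumes "a \<in> A" "b \<in> B"
  shows "\<exists>x. 1 < (\<alpha> a + \<alpha> b) \<bullet> x \<and>
    (\<forall>a'\<in>A. \<forall>b'\<in>B. (a', b') \<noteq> (a, b) \<longrightarrow> (\<alpha> a' + \<alpha> b') \<bullet> x \<le> 1)"
proof -
  define x where "x = (- 1 / (real m - 1)) *\<^sub>R (p a + p b)"
  define c where "c = - 1 / (real m - 1)"
  have x: "\<alpha> i \<bullet> x = - (\<alpha> i \<bullet> p a + \<alpha> i \<bullet> p b) / (real m - 1)" for i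
    by (simp add: x_def inner_add_right add_divide_distrib diff_divide_distrib)
  have m: "real m - 1 > 0"
    using m_gt_1 by simp
  have xA: "\<alpha> a' \<bullet> x = (if a' = a then 1 else c)" if "a' \<in> A" for a'
    unfolding x using that assms m disjoint
    by (subst (1 2) pairing) (auto simp: c_def field_simps)
  have xB: "\<alpha> b' \<bullet> x = (if b' = b then 1 else c)" if "b' \<in> B" for b'
    unfolding x using that assms m disjoint
    by (subst (1 2) pairing) (auto simp: c_def field_simps)
  have neg: "c < 0"
    using m by (simp add: c_def)
  show ?thesis
    by (rule exI[of _ x]) (use assms neg in \<open>auto simp: inner_add_left xA xB\<close>)
qed

end

section \<open>The polytope as a dilated free sum\<close>

text \<open>For \<open>i \<in> {1, 2}\<close>, \<open>same_parity n i\<close> consists of the odd, respectively even, numbers up to \<open>n\<close>.\<close>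
definition same_parity :: "nat \<Rightarrow> nat \<Rightarrow> nat set" where
  "same_parity n i = {k \<in> {1..n}. even (k + i)}"

text \<open>Half of the Laplacian column translated by \<open>- all_ones\<close>, as
  \<open>column_eq\<close> shows.\<close>

definition vertex :: "nat \<Rightarrow> (nat \<Rightarrow> 'n::finite) \<Rightarrow> nat \<Rightarrow> real ^ 'n" where
  "vertex d v j = (\<chi> c. (if inv_into {1..d} v c + 2 = j then real d / 2 + 1 else 0)
     - (if even (inv_into {1..d} v c + j) then 1 else 0))"

text \<open>Indices 1 and 2 give the sums of the odd and of the even coordinates, index
  \<open>k + 2\<close> gives minus coordinate \<open>k\<close>. This numbering pairs each functional
  with the opposite vertex.\<close>

definition normal :: "nat \<Rightarrow> (nat \<Rightarrow> 'n::finite) \<Rightarrow> nat \<Rightarrow> real ^ 'n" where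
  "normal d v j = (\<chi> c. if j \<le> 2 then (if even (inv_into {1..d} v c + j) then 1 else 0)
     else if inv_into {1..d} v c + 2 = j then - 1 else 0)"

lemma finite_same_parity [simp]: "finite (same_parity n i)"
  by (simp add: same_parity_def)

lemma card_same_parity:
  assumes "even n"
  shows "card (same_parity n i) = n div 2"
proof -
  have "card (same_parity (2 * k) i) = k" for k
  proof (induction k)
    case 0
    then show ?case
      by (simp add: same_parity_def)
  next
    case (Suc k)
    define t where "t = (if even i then 2 * k + 2 else 2 * k + 1)"
    have "{1..2 * Suc k} = insert (2 * k + 2) (insert (2 * k + 1) {1..2 * k})"
      by auto
    then have "same_parity (2 * Suc k) i = insert t (same_parity (2 * k) i)"
      by (auto simp: same_parity_def t_def)
    moreover have "t \<notin> same_parity (2 * k) i"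
      by (simp add: same_parity_def t_def)
    ultimately show ?case
      using Suc.IH by simp
  qed
  then show ?thesis
    using assms by (metis dvd_mult_div_cancel)
qed

text \<open>Splits one parity class of vertex indices into \<open>i\<close>, belonging to a
  coordinate sum, and the indices \<open>k + 2\<close>, belonging to single coordinates.\<close>

lemma same_parity_add_2:
  assumes "i \<in> {1, 2}"
  shows "same_parity (n + 2) i = insert i ((\<lambda>k. k + 2) ` same_parity n i)"
proof (intro equalityI subsetI)
  fix k assume k: "k \<in> same_parity (n + 2) i"
  show "k \<in> insert i ((\<lambda>k. k + 2) ` same_parity n i)"
  proof (cases "k \<le> 2")
    case True
    then have "k = 1 \<or> k = 2"
      using k by (auto simp: same_parity_def)
    then show ?thesis
      using k assms by (auto simp: same_parity_def)
  next
    case False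
    then have "k = (k - 2) + 2" "k - 2 \<in> same_parity n i"
      using k by (auto simp: same_parity_def)
    then show ?thesis
      by blast
  qed
qed (use assms in \<open>auto simp: same_parity_def\<close>)

lemma same_parity_partition:
  "same_parity n 1 \<union> same_parity n 2 = {1..n}" "same_parity n 1 \<inter> same_parity n 2 = {}"
  by (auto simp: same_parity_def)

section \<open>Integrality of vertices and normals\<close>

lemma vertex_in_lattice_points:
  assumes "even d"
  shows "vertex d v j \<in> lattice_points"
proof -
  have "real d / 2 + 1 = of_int (int (d div 2 + 1))"
    using assms by (simp add: real_of_nat_div)
  then have "real d / 2 + 1 \<in> \<int>"
    by (metis Ints_of_int)
  then show ?thesis
    by (simp add: lattice_points_def vertex_def)
qed

lemma normal_in_lattice_points: "normal d v j \<in> lattice_points"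
  by (simp add: lattice_points_def normal_def)

lemma inner_lattice_points:
  assumes "x \<in> lattice_points" "y \<in> lattice_points"
  shows "x \<bullet> y \<in> \<int>"
  using assms by (auto simp: inner_vec_def lattice_points_def)

lemma add_lattice_points:
  assumes "x \<in> lattice_points" "y \<in> lattice_points"
  shows "x + y \<in> lattice_points"
  using assms by (auto simp: lattice_points_def)

lemma diff_lattice_points:
  assumes "x \<in> lattice_points" "y \<in> lattice_points"
  shows "x - y \<in> lattice_points"
  using assms by (auto simp: lattice_points_def)

lemma all_ones_in_lattice_points: "all_ones \<in> lattice_points"
  by (simp add: lattice_points_def)

section \<open>Vertices and normals in coordinates\<close>

context
  fixes d :: nat and v :: "nat \<Rightarrow> 'n::finite"
  assumes d: "d \<ge> 2" "even d" and v: "bij_betw v {1..d} (UNIV :: 'n set)"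
begin

text \<open>Stated with \<open>Suc 0\<close>, to which the simplifier rewrites the bound
  \<open>1\<close>.\<close>

lemma inv_into_v: "k \<in> {Suc 0..d} \<Longrightarrow> inv_into {Suc 0..d} v (v k) = k"
  using v by (simp add: bij_betw_inv_into_left)

lemma inv_into_v_mem: "inv_into {1..d} v c \<in> {1..d}"
  using v by (metis UNIV_I bij_betw_imp_surj_on inv_into_into)

lemma vec_eqI_coords:
  assumes "\<And>k. k \<in> {1..d} \<Longrightarrow> x $ v k = y $ v k"
  shows "x = y"
proof -
  have "x $ c = y $ c" for c
    using assms[OF inv_into_v_mem[of c]] v by (simp add: bij_betw_inv_into_right)
  then show ?thesis
    by (simp add: vec_eq_iff)
qed

lemma sum_coords: "(\<Sum>c\<in>UNIV. f c) = (\<Sum>k\<in>{1..d}. f (v k))"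
  using sum.reindex_bij_betw[OF v, of f] by simp

lemma vertex_coord:
  "k \<in> {1..d} \<Longrightarrow> vertex d v j $ v k =
    (if k + 2 = j then real d / 2 + 1 else 0) - (if even (k + j) then 1 else 0)"
  by (simp add: vertex_def inv_into_v)

text \<open>Off the diagonal the entry \<open>- ((- 1) ^ (k + j))\<close> is 1 minus twice the
  indicator of \<open>even (k + j)\<close>; on it, \<open>d + 1 = 1 + 2 * (d / 2)\<close>.\<close>

lemma column_eq:
  assumes "j \<in> {1..d + 2}"
  shows "column d v j = all_ones + 2 *\<^sub>R vertex d v j"
proof (rule vec_eqI_coords)
  fix k assume k: "k \<in> {1..d}"
  then have "column d v j $ v k = of_int (laplacian d (k + 2) j)"
    by (simp add: column_def inv_into_v)
  also have "\<dots> = 1 + 2 * vertex d v j $ v k"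
    unfolding vertex_coord[OF k] using k assms
    by (subst laplacian_eq) (auto simp: minus_one_power_iff)
  finally show "column d v j $ v k = (all_ones + 2 *\<^sub>R vertex d v j) $ v k"
    by simp
qed

lemma normal_inner_le_2:
  assumes "j \<le> 2"
  shows "normal d v j \<bullet> x = (\<Sum>k\<in>same_parity d j. x $ v k)"
proof -
  have "normal d v j \<bullet> x = (\<Sum>k\<in>{1..d}. if even (k + j) then x $ v k else 0)"
    unfolding inner_vec_def sum_coords using assms
    by (intro sum.cong) (auto simp: normal_def inv_into_v)
  then show ?thesis
    unfolding same_parity_def sum.inter_filter[OF finite_atLeastAtMost] .
qed

lemma normal_inner_add_2:
  assumes "k \<in> {1..d}"
  shows "normal d v (k + 2) \<bullet> x = - x $ v k"
proof -
  have "normal d v (k + 2) \<bullet> x = (\<Sum>l\<in>{1..d}. if l = k then - x $ v k else 0)"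
    unfolding inner_vec_def sum_coords using assms
    by (intro sum.cong) (auto simp: normal_def inv_into_v)
  then show ?thesis
    using assms by simp
qed

lemma normal_inner_vertex:
  assumes "i \<in> {1..d + 2}" "j \<in> {1..d + 2}"
  shows "normal d v i \<bullet> vertex d v j =
    (if even (i + j) then 1 - (if i = j then real d / 2 + 1 else 0) else 0)"
proof (cases "i \<le> 2")
  case True
  have "normal d v i \<bullet> vertex d v j = (\<Sum>k\<in>same_parity d i.
      (if k + 2 = j then real d / 2 + 1 else 0) - (if even (i + j) then 1 else 0))"
    unfolding normal_inner_le_2[OF True]
    by (intro sum.cong) (auto simp: same_parity_def vertex_coord)
  \<comment> \<open>Solving \<open>k + 2 = j\<close> for \<open>k\<close> puts the first sum into
    delta form; \<open>j > 2\<close> guards the truncated subtraction.\<close>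
  also have "\<dots> = (\<Sum>k\<in>same_parity d i. if k = j - 2 \<and> j > 2 then real d / 2 + 1 else 0)
      - real (d div 2) * (if even (i + j) then 1 else 0)"
    unfolding sum_subtractf sum_constant card_same_parity[OF d(2)]
    by (intro arg_cong2[where f = "(-)"] sum.cong) (auto simp: same_parity_def)
  also have "(\<Sum>k\<in>same_parity d i. if k = j - 2 \<and> j > 2 then real d / 2 + 1 else 0)
      = (if j > 2 \<and> even (i + j) then real d / 2 + 1 else 0)"
    using assms by (cases "j > 2") (auto simp: same_parity_def)
  also have "real (d div 2) = real d / 2"
    using d(2) by (simp add: real_of_nat_div)
  \<comment> \<open>An index \<open>j \<le> 2\<close> of the parity of \<open>i\<close> is
    \<open>i\<close> itself: its vertex has no entry \<open>d / 2 + 1\<close>, which leaves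
    \<open>- d / 2\<close>.\<close>
  moreover have "j > 2 \<or> i = j" if "even (i + j)"
  proof -
    have "i = 1 \<or> i = 2" "j > 2 \<or> j = 1 \<or> j = 2"
      using True assms by auto
    then show ?thesis
      using that by auto
  qed
  ultimately show ?thesis
    using True by auto
next
  case False
  then have i: "i = (i - 2) + 2" "i - 2 \<in> {1..d}"
    using assms by auto
  have "normal d v i \<bullet> vertex d v j = - vertex d v j $ v (i - 2)"
    using normal_inner_add_2[OF i(2)] i(1) by simp
  then show ?thesis
    unfolding vertex_coord[OF i(2)] using False by auto
qed

text \<open>In coordinate \<open>k\<close>, the large entry of vertex \<open>k + 2\<close>
  contributes \<open>- x $ v k\<close>. The remaining entries contribute the sum of all normals of
  one parity class, where the coordinate sum cancels against the negated coordinates.\<close>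

lemma vertex_expansion:
  "x = - (\<Sum>j\<in>{1..d + 2}. ((normal d v j \<bullet> x) / (real d / 2 + 1)) *\<^sub>R vertex d v j)"
proof (rule vec_eqI_coords)
  fix k assume k: "k \<in> {1..d}"
  define m where "m = real d / 2 + 1"
  have m: "m > 0"
    by (simp add: m_def add_nonneg_pos)
  define i where "i = (if odd k then 1 else 2 :: nat)"
  have i: "i \<in> {1, 2}" "{j \<in> {1..d + 2}. even (k + j)} = same_parity (d + 2) i"
    by (auto simp: i_def same_parity_def)
  define U where "U = {1..d + 2}"
  have U: "finite U" "k + 2 \<in> U"
    using k by (simp_all add: U_def)
  have "(\<Sum>j\<in>U. (normal d v j \<bullet> x) / m * vertex d v j $ v k)
      = (\<Sum>j\<in>U. (if j = k + 2 then normal d v j \<bullet> x else 0)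
         - (if even (k + j) then normal d v j \<bullet> x else 0) / m)"
    unfolding vertex_coord[OF k] m_def[symmetric] using m
    by (intro sum.cong refl) (auto simp: right_diff_distrib)
  also have "\<dots> = (\<Sum>j\<in>U. if j = k + 2 then normal d v j \<bullet> x else 0)
      - (\<Sum>j\<in>U. if even (k + j) then normal d v j \<bullet> x else 0) / m"
    unfolding sum_subtractf sum_divide_distrib ..
  also have "\<dots> = normal d v (k + 2) \<bullet> x - (\<Sum>j\<in>same_parity (d + 2) i. normal d v j \<bullet> x) / m"
    unfolding i(2)[folded U_def, symmetric] sum.inter_filter[OF U(1)]
    using U by (simp only: sum.delta if_True)
  also have "(\<Sum>j\<in>same_parity (d + 2) i. normal d v j \<bullet> x)
      = normal d v i \<bullet> x + (\<Sum>l\<in>same_parity d i. normal d v (l + 2) \<bullet> x)"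
  proof -
    have "i \<notin> (\<lambda>k. k + 2) ` same_parity d i"
      using i(1) by (auto simp: same_parity_def)
    then show ?thesis
      unfolding same_parity_add_2[OF i(1)] by (simp add: sum.reindex del: add_2_eq_Suc')
  qed
  also have "\<dots> = 0"
  proof -
    have "(\<Sum>l\<in>same_parity d i. normal d v (l + 2) \<bullet> x) = (\<Sum>l\<in>same_parity d i. - x $ v l)"
      using normal_inner_add_2 by (intro sum.cong) (auto simp: same_parity_def)
    then show ?thesis
      using i(1) by (auto simp: normal_inner_le_2 sum_negf)
  qed
  also have "normal d v (k + 2) \<bullet> x = - x $ v k"
    by (rule normal_inner_add_2[OF k])
  finally show "x $ v k =
      (- (\<Sum>j\<in>{1..d + 2}. ((normal d v j \<bullet> x) / (real d / 2 + 1)) *\<^sub>R vertex d v j)) $ v k"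
    unfolding vector_uminus_component sum_component vector_scaleR_component U_def m_def by simp
qed

lemma free_sum_vertex:
  "free_sum (same_parity (d + 2) 1) (same_parity (d + 2) 2) (vertex d v) (normal d v) (d div 2 + 1)"
proof
  show "1 < d div 2 + 1"
    using d by auto
  have m: "real (d div 2 + 1) = real d / 2 + 1"
    using d(2) by (simp add: real_of_nat_div)
  show "normal d v i \<bullet> vertex d v j = (if i = j then 1 - real (d div 2 + 1)
      else if (i \<in> same_parity (d + 2) 1) = (j \<in> same_parity (d + 2) 1) then 1 else 0)"
    if "i \<in> same_parity (d + 2) 1 \<union> same_parity (d + 2) 2"
      "j \<in> same_parity (d + 2) 1 \<union> same_parity (d + 2) 2" for i j
    using that normal_inner_vertex[of i j] unfolding same_parity_partition m
    by (auto simp: same_parity_def)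
  show "x = - (\<Sum>j\<in>same_parity (d + 2) 1 \<union> same_parity (d + 2) 2.
      ((normal d v j \<bullet> x) / real (d div 2 + 1)) *\<^sub>R vertex d v j)" for x
    unfolding same_parity_partition m by (rule vertex_expansion)
qed (use d card_same_parity[of "d + 2"] same_parity_partition in auto)

end

text \<open>
  An inequality corresponds to the two simplex vertices, one in each summand, that are opposite to
  the facet it defines.
\<close>
fun opposite :: "ineq \<Rightarrow> nat \<times> nat" where
  "opposite Total = (1, 2)"
| "opposite (Even i) = (1, i + 2)"
| "opposite (Odd j) = (j + 2, 2)"
| "opposite (Pair i j) = (if odd i then (i + 2, j + 2) else (j + 2, i + 2))"

lemma bij_betw_opposite:
  "bij_betw opposite (ineqs d) (same_parity (d + 2) 1 \<times> same_parity (d + 2) 2)"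
proof -
  note parity = same_parity_add_2[OF insertI1] same_parity_add_2[OF insertI2[OF singletonI]]
  show ?thesis
  \<comment> \<open>\<open>opposite\<close> puts the odd index of a \<open>Pair\<close> first;
    \<open>min\<close> and \<open>max\<close> restore the order by size.\<close>
  proof (rule bij_betwI[where g = "\<lambda>(a, b).
      if a = 1 then if b = 2 then Total else Even (b - 2)
      else if b = 2 then Odd (a - 2) else Pair (min (a - 2) (b - 2)) (max (a - 2) (b - 2))"],
    goal_cases)
    case 1
    then show ?case
      by (auto simp: ineqs_def same_parity_def)
  next
    case 2
    then show ?case
      unfolding parity by (auto simp: same_parity_def ineqs_def min_def max_def nat_less_le split: if_splits)
  next
    case (3 i)
    then show ?case
      by (auto simp: ineqs_def min_def max_def)
  next
    case (4 ab)
    then show ?case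
      unfolding parity by (auto simp: same_parity_def min_def max_def)
  qed
qed

text \<open>Every stated inequality has slack exactly 1 at \<open>all_ones\<close>, which becomes
  the right-hand side 1 after centring there.\<close>

lemma facet_normal:
  fixes v :: "nat \<Rightarrow> 'n::finite"
  assumes d: "d \<ge> 2" "even d" and v: "bij_betw v {1..d} (UNIV :: 'n set)"
    and i: "i \<in> ineqs d" "opposite i = (a, b)"
  shows "ineq_lhs d v i x = (normal d v a + normal d v b) \<bullet> x"
    and "ineq_rhs d i = 1 + (normal d v a + normal d v b) \<bullet> all_ones"
proof -
  have odds: "normal d v 1 \<bullet> x = (\<Sum>k\<in>{k\<in>{1..d}. odd k}. x $ v k)"
    and evens: "normal d v 2 \<bullet> x = (\<Sum>k\<in>{k\<in>{1..d}. even k}. x $ v k)" for x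
    using normal_inner_le_2[OF d v] by (simp_all add: same_parity_def)
  have rest: "normal d v (k + 2) \<bullet> x = - x $ v k" if "k \<in> {1..d}" for k x
    using normal_inner_add_2[OF d v that] .
  have half: "real (card {k \<in> {1..d}. odd k}) = real d / 2"
      "real (card {k \<in> {1..d}. even k}) = real d / 2"
    using card_same_parity[OF d(2), of 1] card_same_parity[OF d(2), of 2] d(2)
    by (simp_all add: same_parity_def real_of_nat_div)
  have disj: "{1..d} = {k \<in> {1..d}. odd k} \<union> {k \<in> {1..d}. even k}"
    by auto
  have "(\<Sum>k\<in>{1..d}. x $ v k) =
      (\<Sum>k\<in>{k\<in>{1..d}. odd k}. x $ v k) + (\<Sum>k\<in>{k\<in>{1..d}. even k}. x $ v k)" for x :: "real ^ 'n"
    by (subst disj, rule sum.union_disjoint) auto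
  note eqs = this odds evens rest half
  have "ineq_lhs d v i x = (normal d v a + normal d v b) \<bullet> x \<and>
    ineq_rhs d i = 1 + (normal d v a + normal d v b) \<bullet> all_ones"
  proof (cases i)
    case Total
    then have "a = 1" "b = 2"
      using i by auto
    then show ?thesis
      unfolding Total inner_add_left by (simp only: eqs ineq_lhs.simps ineq_rhs.simps) (use half in simp)
  next
    case (Even k)
    then have "k \<in> {1..d}" "a = 1" "b = k + 2"
      using i by (auto simp: ineqs_def)
    then show ?thesis
      unfolding Even inner_add_left by (simp only: eqs ineq_lhs.simps ineq_rhs.simps) (use half in simp)
  next
    case (Odd k)
    then have "k \<in> {1..d}" "a = k + 2" "b = 2"
      using i by (auto simp: ineqs_def)
    then show ?thesis
      unfolding Odd inner_add_left by (simp only: eqs ineq_lhs.simps ineq_rhs.simps) (use half in simp)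
  next
    case (Pair k l)
    then have kl: "k \<in> {1..d}" "l \<in> {1..d}" "a = k + 2 \<and> b = l + 2 \<or> a = l + 2 \<and> b = k + 2"
      using i by (auto simp: ineqs_def split: if_splits)
    then show ?thesis
      unfolding Pair inner_add_left using rest[OF kl(1)] rest[OF kl(2)] by auto
  qed
  then show "ineq_lhs d v i x = (normal d v a + normal d v b) \<bullet> x"
    "ineq_rhs d i = 1 + (normal d v a + normal d v b) \<bullet> all_ones"
    by auto
qed

lemma reflexiveI:
  fixes P :: "(real ^ 'n::finite) set"
  assumes "finite V" "V \<subseteq> lattice_points" "P = convex hull V"
    and "finite I" "\<And>i. i \<in> I \<Longrightarrow> a i \<in> lattice_points" "P = {x. \<forall>i\<in>I. a i \<bullet> x \<le> 1}"
  shows "reflexive P"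
proof -
  obtain f where f: "bij_betw f {0..<card I} I"
    using ex_bij_betw_nat_finite[OF assms(4)] by blast
  then have I: "I = f ` {0..<card I}"
    by (simp add: bij_betw_imp_surj_on)
  have "\<forall>i<card I. a (f i) \<in> lattice_points"
    using bij_betwE[OF f] assms(5) by auto
  moreover have "P = {x. \<forall>i<card I. a (f i) \<bullet> x \<le> 1}"
    unfolding assms(6) by (subst I) auto
  ultimately have "\<exists>(m::nat) A. (\<forall>i<m. A i \<in> lattice_points) \<and> P = {x. \<forall>i<m. A i \<bullet> x \<le> 1}"
    by (intro exI[of _ "card I"] exI[of _ "\<lambda>i. a (f i)"] conjI)
  moreover have "lattice_polytope P"
    unfolding lattice_polytope_def by (intro exI[of _ V] conjI assms(1-3))
  ultimately show ?thesis
    unfolding reflexive_def by (intro conjI)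
qed

section \<open>The interior polytope as the translated free sum\<close>

theorem theorem6p1:
  fixes d :: nat and v :: "nat \<Rightarrow> 'n::finite" and P Q :: "(real ^ 'n) set"
  assumes "d \<ge> 2" and "even d"
    and "bij_betw v {1..d} (UNIV :: 'n set)"
  defines "P \<equiv> P_tilde d v"
  defines "Q \<equiv> interior_polytope P"
  shows "facet_description Q (ineqs d) (ineq_lhs d v) (ineq_rhs d)
    \<and> reflexive ((\<lambda>x. x - all_ones) ` Q)
    \<and> interior Q \<inter> lattice_points = {all_ones}
    \<and> (\<lambda>x. 2 *\<^sub>R (x - all_ones)) ` Q = (\<lambda>x. x - all_ones) ` P"
proof -
  note dv = assms(1-3)
  define A B where "A = same_parity (d + 2) 1" and "B = same_parity (d + 2) 2"
  define p where "p = vertex d v"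
  define a where "a i = normal d v (fst (opposite i)) + normal d v (snd (opposite i))" for i
  define one :: "real ^ 'n" where "one = all_ones"
  interpret free_sum A B p "normal d v" "d div 2 + 1"
    unfolding A_def B_def p_def by (rule free_sum_vertex[OF dv])
  let ?I = "ineqs d"
  have AB: "A \<union> B = {1..d + 2}"
    unfolding A_def B_def by (rule same_parity_partition)
  have bij: "bij_betw opposite ?I (A \<times> B)"
    unfolding A_def B_def by (rule bij_betw_opposite)
  then have fin: "finite ?I"
    using finite by (simp add: bij_betw_finite)
  have opp: "fst (opposite i) \<in> A" "snd (opposite i) \<in> B" if "i \<in> ?I" for i
    using bij_betwE[OF bij] that by (auto simp: mem_Times_iff)
  \<comment> \<open>Trades quantification over inequalities for quantification over pairs of
    opposite vertices, the form used in \<open>free_sum\<close>.\<close>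
  have pairs: "(\<forall>i\<in>?I. R (fst (opposite i)) (snd (opposite i))) \<longleftrightarrow> (\<forall>a\<in>A. \<forall>b\<in>B. R a b)" for R
  proof -
    have "(\<forall>i\<in>?I. R (fst (opposite i)) (snd (opposite i))) \<longleftrightarrow> (\<forall>q\<in>opposite ` ?I. R (fst q) (snd q))"
      by simp
    also have "opposite ` ?I = A \<times> B"
      using bij by (rule bij_betw_imp_surj_on)
    finally show ?thesis
      by simp
  qed
  have lhs: "ineq_lhs d v i x = a i \<bullet> x" and rhs: "ineq_rhs d i = 1 + a i \<bullet> one"
    if "i \<in> ?I" for i x
    using facet_normal[OF dv that, of "fst (opposite i)" "snd (opposite i)"]
    by (simp_all add: a_def one_def)
  have one: "one \<in> lattice_points"
    unfolding one_def by (rule all_ones_in_lattice_points)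
  have a: "a i \<in> lattice_points" for i
    unfolding a_def by (intro add_lattice_points normal_in_lattice_points)
  have p: "p j \<in> lattice_points" for j
    unfolding p_def by (rule vertex_in_lattice_points[OF dv(2)])
  define H where "H = convex hull (p ` (A \<union> B))"
  have H: "H = {x. \<forall>i\<in>?I. a i \<bullet> x \<le> 1}"
    unfolding H_def convex_hull_vertices a_def
    by (rule Collect_cong) (rule pairs[symmetric])
  have outer: "\<exists>x. 1 < a k \<bullet> x \<and> (\<forall>i\<in>?I - {k}. a i \<bullet> x \<le> 1)" if k: "k \<in> ?I" for k
  proof -
    obtain x where x: "1 < a k \<bullet> x" "\<forall>a'\<in>A. \<forall>b'\<in>B. (a', b') \<noteq> opposite k \<longrightarrow>
        (normal d v a' + normal d v b') \<bullet> x \<le> 1"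
      using outer_point[OF opp[OF k]] by (auto simp: a_def)
    have "opposite i \<noteq> opposite k" if "i \<in> ?I - {k}" for i
      using bij_betw_imp_inj_on[OF bij] k that by (auto dest: inj_onD)
    then have "\<forall>i\<in>?I - {k}. a i \<bullet> x \<le> 1"
      using x(2) opp by (auto simp: a_def)
    then show ?thesis
      using x(1) by blast
  qed
  have nz: "a i \<noteq> 0" if "i \<in> ?I" for i
    using outer[OF that] by force
  have interior: "interior {x. \<forall>i\<in>?I. a i \<bullet> x \<le> b i} = {x. \<forall>i\<in>?I. a i \<bullet> x < b i}" for b
    by (rule interior_halfspaces[OF fin]) (rule nz)
  have P: "P = (\<lambda>x. one + 2 *\<^sub>R x) ` H"
  proof -
    have "column d v ` {1..d + 2} = (\<lambda>x. one + 2 *\<^sub>R x) ` p ` (A \<union> B)"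
      unfolding AB image_image one_def p_def by (intro image_cong refl column_eq[OF dv])
    then show ?thesis
      unfolding P_def P_tilde_def H_def by (simp add: convex_hull_affinity)
  qed
  have P_ineqs: "P = {x. \<forall>i\<in>?I. a i \<bullet> x \<le> a i \<bullet> one + 2}"
  proof (intro equalityI subsetI)
    fix x assume "x \<in> {x. \<forall>i\<in>?I. a i \<bullet> x \<le> a i \<bullet> one + 2}"
    then have "(1 / 2) *\<^sub>R (x - one) \<in> H"
      by (auto simp: H inner_diff_right)
    moreover have "x = one + 2 *\<^sub>R ((1 / 2) *\<^sub>R (x - one))"
      by simp
    ultimately show "x \<in> P"
      unfolding P by blast
  qed (auto simp: P H inner_add_right)
  \<comment> \<open>The candidate for \<open>Q\<close>: the free sum moved to the centre
    \<open>one\<close>, at half the scale of \<open>P\<close>.\<close>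
  define Q' where "Q' = (\<lambda>x. one + x) ` H"
  have Q'_hull: "Q' = convex hull ((\<lambda>x. one + x) ` p ` (A \<union> B))"
    unfolding Q'_def H_def by (rule convex_hull_translation[symmetric])
  have Q'_ineqs: "Q' = {x. \<forall>i\<in>?I. a i \<bullet> x \<le> a i \<bullet> one + 1}"
  proof (intro equalityI subsetI)
    fix x assume "x \<in> {x. \<forall>i\<in>?I. a i \<bullet> x \<le> a i \<bullet> one + 1}"
    then have "x - one \<in> H"
      by (auto simp: H inner_diff_right)
    then show "x \<in> Q'"
      unfolding Q'_def by force
  qed (auto simp: Q'_def H inner_add_right)
  \<comment> \<open>Integral normals take integer values on lattice points, so a strict bound
    \<open>n + 1\<close> improves to \<open>n\<close>. The case \<open>n = 1\<close> leads from the
    interior of \<open>P\<close> to \<open>Q'\<close>, the case \<open>n = 0\<close> from the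
    interior of \<open>Q\<close> to its centre.\<close>
  have gap: "a i \<bullet> x \<le> a i \<bullet> one + real_of_int n"
    if "x \<in> lattice_points" "a i \<bullet> x < a i \<bullet> one + real_of_int (n + 1)" for i x n
  proof -
    have "a i \<bullet> (x - one) \<in> \<int>"
      by (intro inner_lattice_points diff_lattice_points a one that)
    then obtain z where z: "a i \<bullet> (x - one) = real_of_int z"
      by (auto elim: Ints_cases)
    then have "real_of_int z < real_of_int (n + 1)"
      using that by (simp add: inner_diff_right)
    then have "z \<le> n"
      by linarith
    then show ?thesis
      using z by (simp add: inner_diff_right)
  qed
  have "interior P \<inter> lattice_points = Q' \<inter> lattice_points"
    unfolding P_ineqs interior Q'_ineqs using gap[of _ _ 1] by force
  moreover have "convex hull (Q' \<inter> lattice_points) = Q'"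
  proof
    show "convex hull (Q' \<inter> lattice_points) \<subseteq> Q'"
      by (rule hull_minimal) (auto simp: Q'_hull)
    \<comment> \<open>The vertices of \<open>Q'\<close> are themselves lattice points, so its
      lattice points span it.\<close>
    have "(\<lambda>x. one + x) ` p ` (A \<union> B) \<subseteq> Q' \<inter> lattice_points"
      unfolding Q'_hull using one p add_lattice_points by (auto intro: hull_inc)
    then show "Q' \<subseteq> convex hull (Q' \<inter> lattice_points)"
      unfolding Q'_hull by (rule hull_mono)
  qed
  ultimately have Q: "Q = Q'"
    unfolding Q_def interior_polytope_def by simp

  have "facet_description {x. \<forall>i\<in>?I. a i \<bullet> x \<le> a i \<bullet> one + 1} ?I (\<lambda>i x. a i \<bullet> x) (\<lambda>i. a i \<bullet> one + 1)"
  proof (rule facet_description_irredundant[OF fin, where c = one])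
    fix k assume "k \<in> ?I"
    then obtain x where "1 < a k \<bullet> x" "\<forall>i\<in>?I - {k}. a i \<bullet> x \<le> 1"
      using outer by blast
    then show "\<exists>x. a k \<bullet> one + 1 < a k \<bullet> x \<and> (\<forall>i\<in>?I - {k}. a i \<bullet> x \<le> a i \<bullet> one + 1)"
      by (intro exI[of _ "one + x"]) (auto simp: inner_add_right)
  qed simp
  moreover have "bij_betw (\<lambda>i. {x \<in> Q. ineq_lhs d v i x = ineq_rhs d i}) ?I {F. F facet_of Q} \<longleftrightarrow>
      bij_betw (\<lambda>i. {x \<in> Q. a i \<bullet> x = a i \<bullet> one + 1}) ?I {F. F facet_of Q}"
    by (rule bij_betw_cong) (simp add: lhs rhs add.commute)
  ultimately have 1: "facet_description Q ?I (ineq_lhs d v) (ineq_rhs d)"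
    unfolding facet_description_def Q Q'_ineqs by (simp add: lhs rhs add.commute)

  have shift: "(\<lambda>x. x - one) ` Q = H"
    unfolding Q Q'_def image_image by simp
  have 2: "reflexive ((\<lambda>x. x - one) ` Q)"
    unfolding shift
    by (rule reflexiveI[OF _ _ H_def fin a H]) (use finite p in auto)

  have 3: "interior Q \<inter> lattice_points = {one}"
  proof (intro equalityI subsetI)
    fix x assume x: "x \<in> interior Q \<inter> lattice_points"
    then have "a i \<bullet> x \<le> a i \<bullet> one" if "i \<in> ?I" for i
      using gap[of x i 0] that unfolding Q Q'_ineqs interior by auto
    then have "\<forall>i\<in>?I. a i \<bullet> (x - one) \<le> 0"
      by (simp add: inner_diff_right)
    \<comment> \<open>No facet functional is positive at \<open>x - one\<close>, which forces this
      vector to vanish.\<close>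
    then have "x - one = 0"
      unfolding a_def pairs[of "\<lambda>a b. (normal d v a + normal d v b) \<bullet> (x - one) \<le> 0"]
      by (intro nonpos_imp_0) blast
    then show "x \<in> {one}"
      by simp
  qed (use one in \<open>auto simp: Q Q'_ineqs interior\<close>)

  have "(\<lambda>x. 2 *\<^sub>R (x - one)) ` Q = (\<lambda>x. 2 *\<^sub>R x) ` H"
    unfolding shift[symmetric] image_image ..
  also have "\<dots> = (\<lambda>x. x - one) ` P"
    unfolding P image_image by simp
  finally have 4: "(\<lambda>x. 2 *\<^sub>R (x - one)) ` Q = (\<lambda>x. x - one) ` P" .
  show ?thesis
    using 1 2 3 4 unfolding one_def by blast
qed

end
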